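(* Let $m\ge 1$ be an integer and $p\in[0,1]$. Choose a random block of length $2m+2$ over $\{0,1\}$ whose entries are independent, each equal to 1 with probability $p$ and to 0 with probability $1-p$. Let $P_m(00)$ be the probability that this block is an $m$-step preimage of the block $00$ under rule 184. Then $$P_m(00)=(1-p)^2\sum_{k=1}^{m+1}\left(N_{2m,2k-2}-N_{2m,2k+2}\right)p^{m-k+1}(1-p)^{m+k-1},$$ where $N_{a,b}=\binom{a}{\frac12(a+b)}$ if $b\le a$, and $N_{a,b}=0$ if $b>a$.
   Context: Rule 184 is the map $f:\{0,1\}^3\to\{0,1\}$ given by $000\mapsto 0$, $001\mapsto 0$, $010\mapsto 0$, $011\mapsto 1$, $100\mapsto 1$, $101\mapsto 1$, $110\mapsto 0$, $111\mapsto 1$. Its block evolution operator $\mathbf{f}$ maps a block $b_1b_2\ldots b_n$ (with $n>2$, $b_i\in\{0,1\}$) to the block of length $n-2$ given by $f(b_1,b_2,b_3)f(b_2,b_3,b_4)\ldots f(b_{n-2},b_{n-1},b_n)$. A block $b$ of length $k+2m$ is an $m$-step preimage of a block $a$ of length $k$ if $\mathbf{f}^m(b)=a$, where $\mathbf{f}^m$ denotes $\mathbf{f}$ iterated $m$ times. The convention $0^0=1$ is used. *)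

theory Defs
  imports "HOL-Probability.Probability"
begin

text \<open>The alphabet is \<open>bool\<close>, with \<open>True\<close> for the symbol 1 and \<open>False\<close> for 0; blocks are lists.\<close>

fun rule184 :: "bool \<Rightarrow> bool \<Rightarrow> bool \<Rightarrow> bool" where
  "rule184 False False False = False"
| "rule184 False False True  = False"
| "rule184 False True  False = False"
| "rule184 False True  True  = True"
| "rule184 True  False False = True"
| "rule184 True  False True  = True"
| "rule184 True  True  False = False"
| "rule184 True  True  True  = True"

text \<open>Intended for blocks of length greater than 2; shorter blocks are mapped to the empty block.\<close>

definition block_evolution :: "(bool \<Rightarrow> bool \<Rightarrow> bool \<Rightarrow> bool) \<Rightarrow> bool list \<Rightarrow> bool list" where
  "block_evolution f b = map (\<lambda>i. f (b ! i) (b ! (i + 1)) (b ! (i + 2))) [0..<length b - 2]"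

definition is_preimage ::
    "(bool \<Rightarrow> bool \<Rightarrow> bool \<Rightarrow> bool) \<Rightarrow> nat \<Rightarrow> bool list \<Rightarrow> bool list \<Rightarrow> bool" where
  "is_preimage f m b a \<longleftrightarrow>
     length b = length a + 2 * m \<and> (block_evolution f ^^ m) b = a"

definition random_block :: "nat \<Rightarrow> real \<Rightarrow> bool list pmf" where
  "random_block n p = replicate_pmf n (bernoulli_pmf p)"

definition P00 :: "nat \<Rightarrow> real \<Rightarrow> real" where
  "P00 m p = measure_pmf.prob (random_block (2 * m + 2) p)
     {b. is_preimage rule184 m b [False, False]}"

text \<open>Only used for \<open>a\<close> and \<open>b\<close> of equal parity, where the division is exact.\<close>

definition N :: "nat \<Rightarrow> nat \<Rightarrow> nat" where
  "N a b = (if b \<le> a then a choose ((a + b) div 2) else 0)"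

end

theory Submission
  imports Defs
begin

text \<open>
  Read a block as a walk that goes up at each 0 and down at each 1. Rule 184 conserves the number
  of 1s, with current \<open>x(1 - y)\<close> across a neighbouring pair \<open>xy\<close>. Hence the height of the walk of
  the image differs from that of the walk of the block only by a local term, and for a
  block of length at least 4 the walk is positive from its first step on iff that of its image is.
  So the \<open>m\<close>-step preimages of 00 are exactly the blocks of length \<open>2m + 2\<close> with such a
  walk. It begins with two steps up, and the remaining \<open>2m\<close> steps are counted by the formula of
  the reflection principle, which satisfies the recursion on the first step by Pascal's rule.
\<close>

text \<open>The starting height \<open>h\<close> itself is allowed to be 0.\<close>

fun walk_positive :: "nat \<Rightarrow> bool list \<Rightarrow> bool" where
  "walk_positive h [] = True"
| "walk_positive h (False # b) = walk_positive (Suc h) b"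
| "walk_positive h (True # b) = (1 < h \<and> walk_positive (h - 1) b)"

lemma length_block_evolution [simp]: "length (block_evolution f b) = length b - 2"
  by (simp add: block_evolution_def)

lemma block_evolution_Cons3 [simp]:
  "block_evolution f (x # y # z # b) = f x y z # block_evolution f (y # z # b)"
proof -
  have "[0..<Suc n] = 0 # map Suc [0..<n]" for n
    by (simp add: map_Suc_upt upt_conv_Cons del: upt_Suc)
  then show ?thesis
    by (simp add: block_evolution_def del: upt_Suc)
qed

lemma block_evolution_pair [simp]: "block_evolution f [x, y] = []"
  by (simp add: block_evolution_def)

text \<open>
  Here \<open>x\<close> and \<open>y\<close> are consecutive symbols and \<open>h + 1\<close> is the height of the block up to and
  including \<open>x\<close>; by conservation the corresponding height of the image is \<open>h + 2x(1 - y)\<close>.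
\<close>

lemma walk_positive_block_evolution_aux:
  assumes "h = 0 \<Longrightarrow> x \<and> \<not> y"
  shows "walk_positive (if x \<and> \<not> y then Suc (Suc h) else h) (block_evolution rule184 (x # y # b))
    \<longleftrightarrow> walk_positive (Suc h) (y # b)"
  using assms
proof (induction b arbitrary: h x y)
  case Nil
  then show ?case by (cases y) auto
next
  case (Cons z b)
  show ?case
  proof (cases y)
    case True
    then obtain k where k: "h = Suc k"
      using Cons.prems by (cases h) auto
    show ?thesis
    proof (cases "k = 0 \<and> z")
      case True
      with \<open>y\<close> k show ?thesis by (cases x) simp_all
    next
      case False
      then show ?thesis
        using Cons.IH[of k y z] \<open>y\<close> k by (cases x; cases z) simp_all
    qed
  next
    case False
    then show ?thesis
      using Cons.IH[of "Suc h" y z] Cons.prems by (cases x; cases z; cases h) simp_all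
  qed
qed

text \<open>Length 3 is too short: the walk of 010 returns to 0, that of its image 0 does
  not.\<close>

lemma walk_positive_block_evolution:
  assumes "4 \<le> length b"
  shows "walk_positive 0 (block_evolution rule184 b) \<longleftrightarrow> walk_positive 0 b"
proof -
  obtain x y z w r where b: "b = x # y # z # w # r"
    using assms by (auto simp: numeral_eq_Suc Suc_le_length_iff)
  show ?thesis
  \<comment> \<open>A 1 among the first two symbols makes both walks fail within two steps.\<close>
  proof (cases "x \<or> y")
    case True
    then show ?thesis
      unfolding b by (cases x; cases y; cases z; cases w) auto
  next
    case False
    then show ?thesis
      using walk_positive_block_evolution_aux[of 1 False z "w # r"]
      unfolding b by (cases z) simp_all
  qed
qed

lemma funpow_rule184_eq_00_iff:
  assumes "length b = 2 * m + 2"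
  shows "(block_evolution rule184 ^^ m) b = [False, False] \<longleftrightarrow> walk_positive 0 b"
  using assms
proof (induction m arbitrary: b)
  case 0
  then obtain x y where "b = [x, y]"
    by (auto simp: numeral_2_eq_2 length_Suc_conv)
  then show ?case by (cases x; cases y) auto
next
  case (Suc m)
  then show ?case
    by (simp add: funpow_Suc_right walk_positive_block_evolution del: funpow.simps)
qed

definition positive_prob :: "real \<Rightarrow> nat \<Rightarrow> nat \<Rightarrow> real" where
  "positive_prob p h n = measure_pmf.prob (random_block n p) {b. walk_positive h b}"

lemma positive_prob_0 [simp]: "positive_prob p h 0 = 1"
  by (simp add: positive_prob_def random_block_def)

lemma positive_prob_Suc:
  assumes "0 \<le> p" "p \<le> 1"
  shows "positive_prob p h (Suc n) =
    (1 - p) * positive_prob p (Suc h) n + (if 1 < h then p * positive_prob p (h - 1) n else 0)"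
proof -
  have "random_block (Suc n) p = bernoulli_pmf p \<bind> (\<lambda>x. map_pmf ((#) x) (random_block n p))"
    by (simp add: random_block_def map_pmf_def)
  then have "positive_prob p h (Suc n) = measure_pmf.expectation (bernoulli_pmf p)
      (\<lambda>x. measure_pmf.prob (random_block n p) {b. walk_positive h (x # b)})"
    by (simp add: positive_prob_def measure_pmf_bind vimage_def
        measure_pmf.measure_bind[where N = "count_space UNIV"]
        measure_pmf_in_subprob_space)
  then show ?thesis
    using assms by (simp add: positive_prob_def)
qed

text \<open>
  The walks of length \<open>n\<close> from \<open>h\<close> with \<open>z\<close> steps up, less the reflections of those that reach 0.
\<close>

definition ballot :: "nat \<Rightarrow> nat \<Rightarrow> nat \<Rightarrow> real" where
  "ballot h n z = (if n < h + 2 * z then real (n choose z) - real (n choose (z + h)) else 0)"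

lemma ballot_0_left [simp]: "ballot 0 n z = 0"
  by (simp add: ballot_def)

lemma ballot_eq_0 [simp]: "n < z \<Longrightarrow> ballot h n z = 0"
  by (simp add: ballot_def binomial_eq_0)

lemma ballot_Suc_0: "ballot (Suc h) (Suc n) 0 = ballot h n 0"
  by (simp add: ballot_def)

text \<open>All three terms require the same final height to be positive, so Pascal's rule
  suffices.\<close>

lemma ballot_Suc_Suc:
  "ballot (Suc h) (Suc n) (Suc z) = ballot (Suc (Suc h)) n z + ballot h n (Suc z)"
  by (simp add: ballot_def)

lemma positive_prob_eq:
  assumes "0 \<le> p" "p \<le> 1"
  shows "positive_prob p (Suc h) n = (\<Sum>z\<le>n. ballot (Suc h) n z * (1 - p) ^ z * p ^ (n - z))"
proof (induction n arbitrary: h)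
  case 0
  show ?case by (simp add: ballot_def)
next
  case (Suc n)
  \<comment> \<open>At \<open>h = 0\<close> both sides vanish; otherwise the added term
    \<open>z = Suc n\<close> is 0.\<close>
  have down: "(if 1 < Suc h then p * positive_prob p h n else 0) =
      (\<Sum>z\<le>Suc n. ballot h n z * (1 - p) ^ z * p ^ (Suc n - z))"
  proof (cases h)
    case (Suc h')
    show ?thesis
      using Suc.IH[of h'] by (simp add: Suc sum_distrib_left Suc_diff_le mult_ac)
  qed simp
  have up: "(1 - p) * positive_prob p (Suc (Suc h)) n =
      (\<Sum>z\<le>n. ballot (Suc (Suc h)) n z * (1 - p) ^ Suc z * p ^ (n - z))"
    by (simp add: Suc.IH sum_distrib_left mult_ac)
  show ?case
    unfolding positive_prob_Suc[OF assms] diff_Suc_1 down up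
    by (simp only: sum.atMost_Suc_shift ballot_Suc_0 ballot_Suc_Suc diff_Suc_Suc
        distrib_right sum.distrib power_0 diff_zero add_ac)
qed

lemma P00_eq_positive_prob: "P00 m p = positive_prob p 0 (2 * m + 2)"
  unfolding P00_def positive_prob_def
  by (rule measure_pmf.finite_measure_eq_AE)
    (auto simp: AE_measure_pmf_iff random_block_def set_replicate_pmf is_preimage_def
      funpow_rule184_eq_00_iff)

theorem mainTheorem2:
  fixes m :: nat and p :: real
  assumes "m \<ge> 1" and "0 \<le> p" and "p \<le> 1"
  shows "P00 m p = (1 - p) ^ 2 *
    (\<Sum>k = 1..m + 1. (real (N (2 * m) (2 * k - 2)) - real (N (2 * m) (2 * k + 2)))
       * p ^ (m + 1 - k) * (1 - p) ^ (m + k - 1))"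
proof -
  have coeff: "real (N (2 * m) (2 * k - 2)) - real (N (2 * m) (2 * k + 2)) = ballot 2 (2 * m) (m + k - 1)"
    if k: "k \<in> {1..m + 1}" for k
  proof -
    obtain j where "k = Suc j" "j \<le> m"
      using k by (cases k) auto
    moreover have "(2 * m + 2 * j) div 2 = m + j" "(2 * m + (2 * j + 4)) div 2 = m + j + 2"
      by auto
    ultimately show ?thesis
      by (simp add: N_def ballot_def binomial_eq_0)
  qed
  have "P00 m p = (1 - p) ^ 2 * positive_prob p (Suc 1) (2 * m)"
    using assms by (simp add: P00_eq_positive_prob positive_prob_Suc power2_eq_square)
  \<comment> \<open>For \<open>z < m\<close> the final height \<open>2 + 2z - 2m\<close> is not
    positive.\<close>
  also have "positive_prob p (Suc 1) (2 * m) =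
      (\<Sum>z\<in>{m..2 * m}. ballot 2 (2 * m) z * (1 - p) ^ z * p ^ (2 * m - z))"
    unfolding positive_prob_eq[OF assms(2,3)]
    by (rule sum.mono_neutral_cong_right) (auto simp: ballot_def numeral_2_eq_2)
  also have "\<dots> = (\<Sum>k = 1..m + 1. ballot 2 (2 * m) (m + k - 1) * p ^ (m + 1 - k) * (1 - p) ^ (m + k - 1))"
    by (rule sum.reindex_bij_witness[of _ "\<lambda>k. m + k - 1" "\<lambda>z. z + 1 - m"])
       (auto simp: mult_ac intro!: arg_cong[of _ _ "\<lambda>i. p ^ i"])
  also have "\<dots> = (\<Sum>k = 1..m + 1. (real (N (2 * m) (2 * k - 2)) - real (N (2 * m) (2 * k + 2)))
       * p ^ (m + 1 - k) * (1 - p) ^ (m + k - 1))"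
    by (rule sum.cong) (simp_all only: coeff)
  finally show ?thesis .
qed

end
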